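(* Let $R$ be a ring and $M$ an $R$-module. Suppose every quasi sdf-absorbing ideal of $R$ is an sdf-absorbing primary ideal of $R$. Then for every ideal $I$ of $R$ such that $I\ltimes M$ is a quasi sdf-absorbing ideal of the idealization $R\ltimes M$, the ideal $I\ltimes M$ is an sdf-absorbing primary ideal of $R\ltimes M$.
   Context: All rings are commutative with identity. An ideal $I$ of a ring $R$ is called sdf-absorbing if for all non-zero $a,b\in R$, $a^{2}-b^{2}\in I$ implies $a-b\in I$ or $a+b\in I$. A proper ideal $I$ of $R$ is called quasi sdf-absorbing if its radical $\sqrt{I}$ is an sdf-absorbing ideal of $R$. An ideal $I$ of $R$ is called sdf-absorbing primary if for all $a,b\in R$, $a^{2}-b^{2}\in I$ implies $a+b\in\sqrt{I}$ or $a-b\in I$. For an $R$-module $M$, the idealization $R\ltimes M=\{(r,m)\mid r\in R,\ m\in M\}$ is the ring with operations $(r_{1},m_{1})+(r_{2},m_{2})=(r_{1}+r_{2},m_{1}+m_{2})$ and $(r_{1},m_{1})(r_{2},m_{2})=(r_{1}r_{2},\,r_{1}m_{2}+r_{2}m_{1})$. For an ideal $I$ of $R$, $I\ltimes M=\{(r,m)\mid r\in I,\ m\in M\}$, which is an ideal of $R\ltimes M$. *)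

theory Defs
  imports "HOL-Algebra.Ideal" "HOL-Algebra.Module"
begin

definition radical_ideal :: "('a, 'm) ring_scheme \<Rightarrow> 'a set \<Rightarrow> 'a set" where
  "radical_ideal R I = {x \<in> carrier R. \<exists>n::nat. n \<ge> 1 \<and> x [^]\<^bsub>R\<^esub> n \<in> I}"

definition sdf_absorbing :: "'a set \<Rightarrow> ('a, 'm) ring_scheme \<Rightarrow> bool" where
  "sdf_absorbing I R \<longleftrightarrow> ideal I R \<and>
     (\<forall>a\<in>carrier R - {\<zero>\<^bsub>R\<^esub>}. \<forall>b\<in>carrier R - {\<zero>\<^bsub>R\<^esub>}.
        a [^]\<^bsub>R\<^esub> (2::nat) \<ominus>\<^bsub>R\<^esub> b [^]\<^bsub>R\<^esub> (2::nat) \<in> I \<longrightarrow> a \<ominus>\<^bsub>R\<^esub> b \<in> I \<or> a \<oplus>\<^bsub>R\<^esub> b \<in> I)"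

definition quasi_sdf_absorbing :: "'a set \<Rightarrow> ('a, 'm) ring_scheme \<Rightarrow> bool" where
  "quasi_sdf_absorbing I R \<longleftrightarrow>
     ideal I R \<and> I \<noteq> carrier R \<and> sdf_absorbing (radical_ideal R I) R"

definition sdf_absorbing_primary :: "'a set \<Rightarrow> ('a, 'm) ring_scheme \<Rightarrow> bool" where
  "sdf_absorbing_primary I R \<longleftrightarrow> ideal I R \<and>
     (\<forall>a\<in>carrier R. \<forall>b\<in>carrier R.
        a [^]\<^bsub>R\<^esub> (2::nat) \<ominus>\<^bsub>R\<^esub> b [^]\<^bsub>R\<^esub> (2::nat) \<in> I \<longrightarrow>
          a \<oplus>\<^bsub>R\<^esub> b \<in> radical_ideal R I \<or> a \<ominus>\<^bsub>R\<^esub> b \<in> I)"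

definition idealization ::
  "('a, 'm) ring_scheme \<Rightarrow> ('a, 'b, 'n) module_scheme \<Rightarrow> ('a \<times> 'b) ring" where
  "idealization R M =
     \<lparr>carrier = carrier R \<times> carrier M,
      monoid.mult = (\<lambda>(r1, m1) (r2, m2).
        (r1 \<otimes>\<^bsub>R\<^esub> r2, r1 \<odot>\<^bsub>M\<^esub> m2 \<oplus>\<^bsub>M\<^esub> r2 \<odot>\<^bsub>M\<^esub> m1)),
      one = (\<one>\<^bsub>R\<^esub>, \<zero>\<^bsub>M\<^esub>),
      zero = (\<zero>\<^bsub>R\<^esub>, \<zero>\<^bsub>M\<^esub>),
      add = (\<lambda>(r1, m1) (r2, m2). (r1 \<oplus>\<^bsub>R\<^esub> r2, m1 \<oplus>\<^bsub>M\<^esub> m2))\<rparr>"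

text \<open>The set underlying the ideal of \<^const>\<open>idealization\<close> determined by an ideal of
  the base ring is \<^term>\<open>I \<times> carrier M\<close>.\<close>

lemma cring_idealization:
  assumes "module R M"
  shows "cring (idealization R M)"
proof -
  interpret module R M by fact
  show ?thesis
  proof (rule cringI)
    show "abelian_group (idealization R M)"
    proof (rule abelian_groupI)
      fix x assume "x \<in> carrier (idealization R M)"
      then show "\<exists>y\<in>carrier (idealization R M).
          y \<oplus>\<^bsub>idealization R M\<^esub> x = \<zero>\<^bsub>idealization R M\<^esub>"
        by (intro bexI[of _ "(\<ominus>\<^bsub>R\<^esub> fst x, \<ominus>\<^bsub>M\<^esub> snd x)"])
           (auto simp: idealization_def R.l_neg M.l_neg)
    qed (auto simp: idealization_def R.a_ac M.a_ac)
    show "comm_monoid (idealization R M)"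
      by (rule comm_monoidI)
         (auto simp: idealization_def R.m_ac smult_r_distr smult_assoc1[symmetric]
            M.a_ac)
  qed (auto simp: idealization_def R.l_distr smult_l_distr smult_r_distr M.a_ac)
qed

lemma ideal_idealization:
  assumes "module R M" "ideal I R"
  shows "ideal (I \<times> carrier M) (idealization R M)"
proof -
  interpret module R M by fact
  interpret I: ideal I R by fact
  interpret X: cring "idealization R M" using assms(1) by (rule cring_idealization)
  have I: "r \<in> carrier R" if "r \<in> I" for r
    using that by (rule I.Icarr)
  have neg: "\<ominus>\<^bsub>idealization R M\<^esub> x = (\<ominus>\<^bsub>R\<^esub> fst x, \<ominus>\<^bsub>M\<^esub> snd x)"
    if "x \<in> carrier (idealization R M)" for x
    using that
    by (intro X.minus_equality) (auto simp: idealization_def R.l_neg M.l_neg)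
  have "subgroup (I \<times> carrier M) (add_monoid (idealization R M))"
  proof (rule X.add.subgroupI)
    fix a assume a: "a \<in> I \<times> carrier M"
    then have "a \<in> carrier (idealization R M)"
      using I by (auto simp: idealization_def)
    from neg[OF this] a show "\<ominus>\<^bsub>idealization R M\<^esub> a \<in> I \<times> carrier M"
      by auto
  next
    show "I \<times> carrier M \<noteq> {}"
      using I.zero_closed M.zero_closed by blast
  qed (auto simp: idealization_def I)
  then show ?thesis
    by (intro idealI X.ring_axioms)
       (auto simp: idealization_def I I.I_l_closed I.I_r_closed)
qed

end

theory Submission
  imports Defs "HOL-Algebra.RingHom"
begin

text \<open>The ideal \<open>I \<times> carrier M\<close> is the preimage of \<open>I\<close> under the surjective
  projection from the idealization onto \<open>R\<close>. Taking radicals commutes with taking preimages.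
  Along a surjective homomorphism the quasi sdf-absorbing property descends from the preimage of
  an ideal to the ideal itself, and the sdf-absorbing primary property lifts back to the
  preimage.\<close>

context ring_hom_cring
begin

lemma hom_minus: "a \<in> carrier R \<Longrightarrow> b \<in> carrier R \<Longrightarrow> h (a \<ominus> b) = h a \<ominus>\<^bsub>S\<^esub> h b"
  by (simp add: a_minus_def)

lemma hom_square_diff:
  assumes "a \<in> carrier R" "b \<in> carrier R"
  shows "h (a [^] (2::nat) \<ominus> b [^] (2::nat)) = h a [^]\<^bsub>S\<^esub> (2::nat) \<ominus>\<^bsub>S\<^esub> h b [^]\<^bsub>S\<^esub> (2::nat)"
  using assms by (simp add: hom_minus ring.hom_nat_pow)

text \<open>Since \<open>h\<close> preserves powers, \<open>x\<close> and \<open>h x\<close> witness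
  membership in the two radicals with the same exponent.\<close>

lemma radical_ideal_preimage:
  "radical_ideal R {x \<in> carrier R. h x \<in> I} = {x \<in> carrier R. h x \<in> radical_ideal S I}"
  by (auto simp: radical_ideal_def ring.hom_nat_pow)

text \<open>The sdf conditions include being an ideal, so descent has to carry that along too.
  Applied to a radical, it yields that the radical in \<open>S\<close> is an ideal. The inclusion
  \<open>sub\<close> matters because a preimage does not see elements of \<open>I\<close> outside
  the image of \<open>h\<close>.\<close>

lemma ideal_preimage_imp_ideal:
  assumes surj: "h ` carrier R = carrier S" and sub: "I \<subseteq> carrier S"
    and ideal: "ideal {x \<in> carrier R. h x \<in> I} R"
  shows "ideal I S"
proof -
  note subgrp = ideal.axioms(1)[OF ideal]
  have lift: "\<exists>x\<in>carrier R. y = h x" if "y \<in> carrier S" for y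
    using that surj by blast
  \<comment> \<open>The closure facts are first stated for images \<open>h x\<close>, where they are
    the closure of the preimage pushed through \<open>h\<close>; \<open>lift\<close> then covers
    arbitrary elements.\<close>
  have zero: "\<zero>\<^bsub>S\<^esub> \<in> I"
    using additive_subgroup.zero_closed[OF subgrp] by simp
  have inv: "\<ominus>\<^bsub>S\<^esub> h x \<in> I" if "x \<in> carrier R" "h x \<in> I" for x
    using additive_subgroup.a_inv_closed[OF subgrp, of x] that by simp
  have add: "h x \<oplus>\<^bsub>S\<^esub> h y \<in> I"
    if "x \<in> carrier R" "h x \<in> I" "y \<in> carrier R" "h y \<in> I" for x y
    using additive_subgroup.a_closed[OF subgrp, of x y] that by simp
  have mult: "h z \<otimes>\<^bsub>S\<^esub> h x \<in> I" "h x \<otimes>\<^bsub>S\<^esub> h z \<in> I"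
    if "x \<in> carrier R" "h x \<in> I" "z \<in> carrier R" for x z
    using ideal.I_l_closed[OF ideal, of x z] ideal.I_r_closed[OF ideal, of x z] that by simp_all
  show ?thesis
  proof (rule idealI)
    show "ring S" ..
    show "subgroup I (add_monoid S)"
    proof (rule S.add.subgroupI)
      show "I \<subseteq> carrier S" by (fact sub)
      show "I \<noteq> {}" using zero by blast
      show "\<ominus>\<^bsub>S\<^esub> a \<in> I" if "a \<in> I" for a
        using lift[of a] inv sub that by blast
      show "a \<oplus>\<^bsub>S\<^esub> b \<in> I" if "a \<in> I" "b \<in> I" for a b
        using lift[of a] lift[of b] add sub that by blast
    qed
    show "y \<otimes>\<^bsub>S\<^esub> a \<in> I" "a \<otimes>\<^bsub>S\<^esub> y \<in> I" if "a \<in> I" "y \<in> carrier S" for a y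
      using lift[of a] lift[of y] mult sub that by blast+
  qed
qed

lemma sdf_absorbing_preimageD:
  assumes surj: "h ` carrier R = carrier S" and sub: "I \<subseteq> carrier S"
    and sdf: "sdf_absorbing {x \<in> carrier R. h x \<in> I} R"
  shows "sdf_absorbing I S"
  unfolding sdf_absorbing_def
proof (intro conjI ballI impI)
  show "ideal I S"
    using ideal_preimage_imp_ideal[OF surj sub] sdf by (simp add: sdf_absorbing_def)
next
  fix a b
  assume ab: "a \<in> carrier S - {\<zero>\<^bsub>S\<^esub>}" "b \<in> carrier S - {\<zero>\<^bsub>S\<^esub>}"
    and diff: "a [^]\<^bsub>S\<^esub> (2::nat) \<ominus>\<^bsub>S\<^esub> b [^]\<^bsub>S\<^esub> (2::nat) \<in> I"
  from ab obtain x y where xy: "x \<in> carrier R" "a = h x" "y \<in> carrier R" "b = h y"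
    using surj by blast
  \<comment> \<open>As \<open>h\<close> sends zero to zero, every lift of a nonzero element is
    nonzero, so the restriction to nonzero elements survives the descent.\<close>
  with ab have "x \<in> carrier R - {\<zero>}" "y \<in> carrier R - {\<zero>}"
    by auto
  moreover from xy diff have "x [^] (2::nat) \<ominus> y [^] (2::nat) \<in> {x \<in> carrier R. h x \<in> I}"
    by (simp add: hom_square_diff)
  ultimately have "x \<ominus> y \<in> {x \<in> carrier R. h x \<in> I} \<or> x \<oplus> y \<in> {x \<in> carrier R. h x \<in> I}"
    using sdf unfolding sdf_absorbing_def by blast
  with xy show "a \<ominus>\<^bsub>S\<^esub> b \<in> I \<or> a \<oplus>\<^bsub>S\<^esub> b \<in> I"
    by (auto simp: hom_minus)
qed

lemma quasi_sdf_absorbing_preimageD: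
  assumes surj: "h ` carrier R = carrier S" and sub: "I \<subseteq> carrier S"
    and quasi: "quasi_sdf_absorbing {x \<in> carrier R. h x \<in> I} R"
  shows "quasi_sdf_absorbing I S"
  unfolding quasi_sdf_absorbing_def
proof (intro conjI)
  show "ideal I S"
    using ideal_preimage_imp_ideal[OF surj sub] quasi by (simp add: quasi_sdf_absorbing_def)
  \<comment> \<open>The preimage of \<open>carrier S\<close> is all of \<open>carrier R\<close>, so
    a proper preimage forces \<open>I\<close> to be proper.\<close>
  show "I \<noteq> carrier S"
    using quasi by (auto simp: quasi_sdf_absorbing_def)
  show "sdf_absorbing (radical_ideal S I) S"
  proof (rule sdf_absorbing_preimageD[OF surj])
    show "radical_ideal S I \<subseteq> carrier S"
      by (auto simp: radical_ideal_def)
    show "sdf_absorbing {x \<in> carrier R. h x \<in> radical_ideal S I} R"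
      using quasi by (simp add: quasi_sdf_absorbing_def radical_ideal_preimage)
  qed
qed

text \<open>The primary condition ranges over all elements, zero included, so it can be applied to
  \<open>h a\<close> and \<open>h b\<close> even when one of them vanishes.\<close>

lemma sdf_absorbing_primary_preimageI:
  assumes ideal: "ideal {x \<in> carrier R. h x \<in> I} R" and primary: "sdf_absorbing_primary I S"
  shows "sdf_absorbing_primary {x \<in> carrier R. h x \<in> I} R"
  unfolding sdf_absorbing_primary_def radical_ideal_preimage
proof (intro conjI ballI impI)
  fix a b
  assume ab: "a \<in> carrier R" "b \<in> carrier R"
    and "a [^] (2::nat) \<ominus> b [^] (2::nat) \<in> {x \<in> carrier R. h x \<in> I}"
  then have "h a [^]\<^bsub>S\<^esub> (2::nat) \<ominus>\<^bsub>S\<^esub> h b [^]\<^bsub>S\<^esub> (2::nat) \<in> I"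
    by (simp add: hom_square_diff)
  with ab primary have "h a \<oplus>\<^bsub>S\<^esub> h b \<in> radical_ideal S I \<or> h a \<ominus>\<^bsub>S\<^esub> h b \<in> I"
    unfolding sdf_absorbing_primary_def by blast
  with ab show "a \<oplus> b \<in> {x \<in> carrier R. h x \<in> radical_ideal S I}
      \<or> a \<ominus> b \<in> {x \<in> carrier R. h x \<in> I}"
    by (auto simp: hom_minus)
qed (fact ideal)

end

text \<open>The first component of a sum or product in the idealization is computed in
  \<open>R\<close> alone.\<close>

lemma ring_hom_cring_fst_idealization:
  assumes "cring R" "module R M"
  shows "ring_hom_cring (idealization R M) R fst"
proof -
  interpret X: cring "idealization R M" using assms(2) by (rule cring_idealization)
  interpret R: cring R by fact
  show ?thesis
    by unfold_locales (auto simp: ring_hom_def idealization_def)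
qed

lemma fst_image_carrier_idealization:
  assumes "module R M"
  shows "fst ` carrier (idealization R M) = carrier R"
proof -
  interpret module R M by fact
  show ?thesis
    using M.zero_closed by (auto simp: idealization_def)
qed

theorem theorem4p3:
  fixes R :: "('a, 'm) ring_scheme" and M :: "('a, 'b, 'n) module_scheme"
  assumes "cring R" and "module R M"
    and "\<And>J. quasi_sdf_absorbing J R \<Longrightarrow> sdf_absorbing_primary J R"
  shows "\<forall>I. ideal I R \<longrightarrow>
           quasi_sdf_absorbing (I \<times> carrier M) (idealization R M) \<longrightarrow>
           sdf_absorbing_primary (I \<times> carrier M) (idealization R M)"
proof (intro allI impI)
  fix I
  assume I: "ideal I R" and quasi: "quasi_sdf_absorbing (I \<times> carrier M) (idealization R M)"
  interpret ring_hom_cring "idealization R M" R fst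
    using assms(1,2) by (rule ring_hom_cring_fst_idealization)
  have sub: "I \<subseteq> carrier R"
    using ideal.Icarr[OF I] by blast
  \<comment> \<open>This equation brings the product into the form the transfer lemmas expect;
    \<open>sub\<close> places its first components in \<open>carrier R\<close>.\<close>
  then have preimage: "I \<times> carrier M = {x \<in> carrier (idealization R M). fst x \<in> I}"
    by (auto simp: idealization_def)
  have "quasi_sdf_absorbing I R"
    using quasi_sdf_absorbing_preimageD[OF fst_image_carrier_idealization[OF assms(2)] sub]
      quasi by (simp add: preimage)
  then have "sdf_absorbing_primary I R"
    by (rule assms(3))
  then show "sdf_absorbing_primary (I \<times> carrier M) (idealization R M)"
    using sdf_absorbing_primary_preimageI[of I] ideal_idealization[OF assms(2) I]
    by (simp add: preimage)
qed

end
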